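(* Let $N,U,L\ge 1$ and $C\ge 2$ be integers, and let all problem data (including arbitrary real weights $\rho_{\mathrm{com}},\rho_{\mathrm{sen}}$) and the problems $\mathcal P$ and $\mathcal P''$ be as defined in the context. Then the nonconvex mixed-integer nonlinear program $\mathcal P$ is equivalent to the mixed-integer linear program $\mathcal P''$, in the following sense. A triple $(\mathbf w,\boldsymbol\mu,\tau)$ is feasible for $\mathcal P$ if and only if there exist $\mathbf W$, $\mathbf X=(\mathbf x_n)_{n\in\mathcal N}$ and $\mathbf Y=(\mathbf Y_{n,m})_{n\in\mathcal N,\,m\in\mathcal M_n}$ such that $(\mathbf W,\mathbf X,\mathbf Y,\boldsymbol\mu,\tau)$ is feasible for $\mathcal P''$ and $[\mathbf w]_n=\mathbf s^{\mathrm T}\mathbf x_n$ for all $n\in\mathcal N$. Since both problems have the same objective $f(\boldsymbol\mu,\tau)$, they have the same optimal value, and if $(\mathbf W,\mathbf X,\mathbf Y,\boldsymbol\mu,\tau)$ is a globally optimal solution of $\mathcal P''$, then $(\mathbf w,\boldsymbol\mu,\tau)$ with $[\mathbf w]_n=\mathbf s^{\mathrm T}\mathbf x_n$, $n\in\mathcal N$, is a globally optimal solution of $\mathcal P$.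
   Context: Index sets: $\mathcal N=\{1,\dots,N\}$, $\mathcal U=\{1,\dots,U\}$, $\mathcal L=\{1,\dots,L\}$, and $\mathcal M_n=\{n+1,\dots,N\}$ for $n\in\mathcal N$ (so $\mathcal M_N=\emptyset$). $\mathbf 1$ is the all-ones vector, $(\cdot)^{\mathrm T}$ the transpose, $(\cdot)^{\mathrm H}$ the conjugate transpose, $(\cdot)^*$ the entrywise complex conjugate, and $j=\sqrt{-1}$. $[\mathbf A]_{l,:}$ and $[\mathbf A]_{:,i}$ denote the $l$-th row and $i$-th column of $\mathbf A$. Data: $P_{\mathrm{tx}}>0$; $\delta=\sqrt{P_{\mathrm{tx}}/N}$; $L$ phases $\phi_1,\dots,\phi_L$ with set of admissible values $\mathcal S=\{\delta e^{j\phi_1},\dots,\delta e^{j\phi_L}\}$ having $L$ elements; $\mathbf s=[\delta e^{j\phi_1},\dots,\delta e^{j\phi_L}]^{\mathrm T}\in\mathbb C^{L\times 1}$; $\mathbf S=\mathbf s^*\mathbf s^{\mathrm T}$. Noise powers $\sigma_{\mathrm{com}}^2,\sigma_{\mathrm{sen}}^2>0$; channels $\mathbf h_u\in\mathbb C^{N\times1}$ and $\widetilde{\mathbf H}_u=\mathbf h_u\mathbf h_u^{\mathrm H}/\sigma_{\mathrm{com}}^2$ for $u\in\mathcal U$; SNR threshold $\Gamma_{\mathrm{th}}\ge 0$. Reflection coefficient $\alpha>0$; steering vector $\mathbf a(\theta)=[e^{j\pi\frac{-N+1}{2}\cos\theta},\dots,e^{j\pi\frac{N-1}{2}\cos\theta}]^{\mathrm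 T}\in\mathbb C^{N\times1}$, whose $n$-th entry is $e^{j\pi\frac{2n-N-1}{2}\cos\theta}$; $\widetilde{\mathbf G}(\theta)=\alpha\,\mathbf a(\theta)\mathbf a^{\mathrm H}(\theta)/\sigma_{\mathrm{sen}}^2$. For a nominal angle $\theta_0\in\mathbb R$ and uncertainty $\Delta\ge0$, $\Theta=\{\theta_0-\Delta+\tfrac{2\Delta}{C-1}c : c=0,\dots,C-1\}$. Objective: $f(\boldsymbol\mu,\tau)=\rho_{\mathrm{com}}\,\mathbf 1^{\mathrm T}\boldsymbol\mu+\rho_{\mathrm{sen}}\,\tau$, with $\boldsymbol\mu=[\mu_1,\dots,\mu_U]^{\mathrm T}$. Problem $\mathcal P$: maximize $f(\boldsymbol\mu,\tau)$ over $\mathbf w\in\mathbb C^{N\times1}$, $\boldsymbol\mu\in\mathbb R^U$, $\tau\in\mathbb R$ subject to: - $[\mathbf w]_n\in\mathcal S$ for all $n\in\mathcal N$; - $\mu_u\in\{0,1\}$ for all $u\in\mathcal U$; - $\mathbf w^{\mathrm H}\widetilde{\mathbf H}_u\mathbf w\ge\mu_u\Gamma_{\mathrm{th}}$ for all $u\in\mathcal U$; - $\tau\ge0$; - $\mathbf w^{\mathrm H}\widetilde{\mathbf G}(\theta)\mathbf w\ge\tau$ for all $\theta\in\Theta$. Problem $\mathcal P''$: maximize $f(\boldsymbol\mu,\tau)$ over $\mathbf W\in\mathbb C^{N\times N}$, $\mathbf X=(\mathbf x_n)_{n\in\mathcal N}$ with $\mathbf x_n\in\mathbb R^{L}$, $\mathbf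 Y=(\mathbf Y_{n,m})_{n\in\mathcal N,m\in\mathcal M_n}$ with $\mathbf Y_{n,m}\in\mathbb R^{L\times L}$, $\boldsymbol\mu\in\mathbb R^U$, $\tau\in\mathbb R$ subject to: - $\mu_u\in\{0,1\}$ for all $u\in\mathcal U$; - $\mathrm{Tr}(\widetilde{\mathbf H}_u\mathbf W)\ge\mu_u\Gamma_{\mathrm{th}}$ for all $u\in\mathcal U$; - $\tau\ge0$; - $\mathrm{Tr}(\widetilde{\mathbf G}(\theta)\mathbf W)\ge\tau$ for all $\theta\in\Theta$; - $[\mathbf x_n]_l\in\{0,1\}$ for all $n\in\mathcal N,l\in\mathcal L$; - $\mathbf 1^{\mathrm T}\mathbf x_n=1$ for all $n\in\mathcal N$; - $[\mathbf W]_{m,n}=[\mathbf W]_{n,m}^*$ for all $n\in\mathcal N,m\in\mathcal M_n$; - $[\mathbf W]_{n,n}=\delta^2$ for all $n\in\mathcal N$; - $[\mathbf W]_{n,m}=\mathrm{Tr}(\mathbf S\mathbf Y_{n,m})$ for all $n\in\mathcal N,m\in\mathcal M_n$; - $[\mathbf Y_{n,m}]_{l,i}\in[0,1]$ for all $n\in\mathcal N,m\in\mathcal M_n,l,i\in\mathcal L$; - $\mathbf 1^{\mathrm T}[\mathbf Y_{n,m}]_{:,i}=[\mathbf x_m]_i$ for all $n\in\mathcal N,m\in\mathcal M_n,i\in\mathcal L$; - $[\mathbf Y_{n,m}]_{l,:}\mathbf 1=[\mathbf x_n]_l$ for all $n\in\mathcal N,m\in\mathcal M_n,l\in\mathcal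 L$. (The traces in the inequality constraints are real because the constraints force $\mathbf W$ to be Hermitian.) *)

theory Defs
  imports "Jordan_Normal_Form.Matrix" "HOL-Library.Extended_Real"
begin

text \<open>
  Vectors and matrices are those of \<^theory>\<open>Jordan_Normal_Form.Matrix\<close>, whose entries are
  indexed from 0.  Hence the index sets \<open>{1,...,N}\<close>, \<open>{1,...,U}\<close>, \<open>{1,...,L}\<close> and
  \<open>{n+1,...,N}\<close> of the mathematical text appear as \<open>{..<N}\<close>, \<open>{..<U}\<close>, \<open>{..<L}\<close>
  and \<open>{n<..<N}\<close>.
\<close>

definition trace :: "'a::comm_monoid_add mat \<Rightarrow> 'a" where
  "trace A = (\<Sum>i<dim_row A. A $$ (i, i))"

definition all_ones :: "nat \<Rightarrow> 'a::one vec" where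
  "all_ones k = vec k (\<lambda>_. 1)"

text \<open>\<open>outer_prod u v\<close> is \<open>u v\<^sup>T\<close>, without conjugation.\<close>

definition outer_prod :: "'a::times vec \<Rightarrow> 'a vec \<Rightarrow> 'a mat" where
  "outer_prod u v = mat (dim_vec u) (dim_vec v) (\<lambda>(i, j). u $ i * v $ j)"

text \<open>\<open>herm_form A w\<close> is \<open>w\<^sup>H A w\<close>.\<close>

definition herm_form :: "complex mat \<Rightarrow> complex vec \<Rightarrow> complex" where
  "herm_form A w = conjugate w \<bullet> (A *\<^sub>v w)"

text \<open>The fields \<open>noise_com\<close> and \<open>noise_sen\<close> are the noise powers, i.e. the squares
  \<open>\<sigma>\<^sup>2\<close>.\<close>

record problem_data =
  antennas :: nat       (* N *)
  users :: nat          (* U *)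
  phase_count :: nat    (* L *)
  angle_count :: nat    (* C *)
  power :: real         (* P_tx *)
  phases :: "real vec"  (* phi *)
  noise_com :: real
  noise_sen :: real
  channel :: "nat \<Rightarrow> complex vec"  (* h_u *)
  snr_min :: real       (* Gamma_th *)
  refl :: real          (* alpha *)
  angle0 :: real        (* theta_0 *)
  uncertainty :: real   (* Delta *)
  weight_com :: real
  weight_sen :: real

definition amplitude :: "problem_data \<Rightarrow> real" where
  "amplitude D = sqrt (power D / real (antennas D))"

definition symbols :: "problem_data \<Rightarrow> complex vec" where
  "symbols D = vec (phase_count D)
     (\<lambda>l. complex_of_real (amplitude D) * exp (\<i> * complex_of_real (phases D $ l)))"

definition admissible :: "problem_data \<Rightarrow> complex set" where
  "admissible D = set\<^sub>v (symbols D)"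

definition valid_data :: "problem_data \<Rightarrow> bool" where
  "valid_data D \<longleftrightarrow>
     antennas D \<ge> 1 \<and> users D \<ge> 1 \<and> phase_count D \<ge> 1 \<and> angle_count D \<ge> 2 \<and>
     power D > 0 \<and>
     phases D \<in> carrier_vec (phase_count D) \<and>
     card (admissible D) = phase_count D \<and>
     noise_com D > 0 \<and> noise_sen D > 0 \<and>
     (\<forall>u<users D. channel D u \<in> carrier_vec (antennas D)) \<and>
     snr_min D \<ge> 0 \<and> refl D > 0 \<and> uncertainty D \<ge> 0"

definition S_mat :: "problem_data \<Rightarrow> complex mat" where
  "S_mat D = outer_prod (conjugate (symbols D)) (symbols D)"

definition H_mat :: "problem_data \<Rightarrow> nat \<Rightarrow> complex mat" where
  "H_mat D u = complex_of_real (1 / noise_com D) \<cdot>\<^sub>m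
     outer_prod (channel D u) (conjugate (channel D u))"

text \<open>The exponent \<open>(2n - N - 1) / 2\<close> is for the one-based index, here \<open>n + 1\<close>.\<close>

definition steering :: "problem_data \<Rightarrow> real \<Rightarrow> complex vec" where
  "steering D \<theta> = vec (antennas D)
     (\<lambda>n. exp (\<i> * complex_of_real
        (pi * ((2 * real (n + 1) - real (antennas D) - 1) / 2) * cos \<theta>)))"

definition G_mat :: "problem_data \<Rightarrow> real \<Rightarrow> complex mat" where
  "G_mat D \<theta> = complex_of_real (refl D / noise_sen D) \<cdot>\<^sub>m
     outer_prod (steering D \<theta>) (conjugate (steering D \<theta>))"

definition angles :: "problem_data \<Rightarrow> real set" where
  "angles D = (\<lambda>c. angle0 D - uncertainty D
      + 2 * uncertainty D / (real (angle_count D) - 1) * real c) ` {..<angle_count D}"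

definition objective :: "problem_data \<Rightarrow> real vec \<Rightarrow> real \<Rightarrow> real" where
  "objective D \<mu> \<tau> = weight_com D * (all_ones (users D) \<bullet> \<mu>) + weight_sen D * \<tau>"

text \<open>The complex numbers compared with real ones below are real, by
  \<open>herm_form_real\<close> and \<open>trace_mult_real\<close> at the end of this theory, so that
  \<^const>\<open>Re\<close> only converts the type.\<close>

definition feasible_P :: "problem_data \<Rightarrow> complex vec \<Rightarrow> real vec \<Rightarrow> real \<Rightarrow> bool" where
  "feasible_P D w \<mu> \<tau> \<longleftrightarrow>
     (let N = antennas D; U = users D in
      w \<in> carrier_vec N \<and> \<mu> \<in> carrier_vec U \<and>
      (\<forall>n<N. w $ n \<in> admissible D) \<and>
      (\<forall>u<U. \<mu> $ u \<in> {0, 1}) \<and>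
      (\<forall>u<U. Re (herm_form (H_mat D u) w) \<ge> \<mu> $ u * snr_min D) \<and>
      \<tau> \<ge> 0 \<and>
      (\<forall>\<theta>\<in>angles D. Re (herm_form (G_mat D \<theta>) w) \<ge> \<tau>))"

text \<open>In \<open>feasible_P2\<close>, only the values \<open>X n\<close> for \<open>n < N\<close> and \<open>Y n m\<close> for
  \<open>n < m < N\<close> are decision variables; all other values of the functions are ignored.\<close>

definition feasible_P2 ::
  "problem_data \<Rightarrow> complex mat \<Rightarrow> (nat \<Rightarrow> real vec) \<Rightarrow> (nat \<Rightarrow> nat \<Rightarrow> real mat) \<Rightarrow>
    real vec \<Rightarrow> real \<Rightarrow> bool" where
  "feasible_P2 D W X Y \<mu> \<tau> \<longleftrightarrow>
     (let N = antennas D; U = users D; L = phase_count D in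
      W \<in> carrier_mat N N \<and>
      (\<forall>n<N. X n \<in> carrier_vec L) \<and>
      (\<forall>n<N. \<forall>m\<in>{n<..<N}. Y n m \<in> carrier_mat L L) \<and>
      \<mu> \<in> carrier_vec U \<and>
      (\<forall>u<U. \<mu> $ u \<in> {0, 1}) \<and>
      (\<forall>u<U. Re (trace (H_mat D u * W)) \<ge> \<mu> $ u * snr_min D) \<and>
      \<tau> \<ge> 0 \<and>
      (\<forall>\<theta>\<in>angles D. Re (trace (G_mat D \<theta> * W)) \<ge> \<tau>) \<and>
      (\<forall>n<N. \<forall>l<L. X n $ l \<in> {0, 1}) \<and>
      (\<forall>n<N. all_ones L \<bullet> X n = 1) \<and>
      (\<forall>n<N. \<forall>m\<in>{n<..<N}. W $$ (m, n) = cnj (W $$ (n, m))) \<and>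
      (\<forall>n<N. W $$ (n, n) = complex_of_real ((amplitude D)\<^sup>2)) \<and>
      (\<forall>n<N. \<forall>m\<in>{n<..<N}.
         W $$ (n, m) = trace (S_mat D * map_mat complex_of_real (Y n m))) \<and>
      (\<forall>n<N. \<forall>m\<in>{n<..<N}. \<forall>l<L. \<forall>i<L. Y n m $$ (l, i) \<in> {0..1}) \<and>
      (\<forall>n<N. \<forall>m\<in>{n<..<N}. \<forall>i<L. all_ones L \<bullet> col (Y n m) i = X m $ i) \<and>
      (\<forall>n<N. \<forall>m\<in>{n<..<N}. \<forall>l<L. row (Y n m) l \<bullet> all_ones L = X n $ l))"

definition beam :: "problem_data \<Rightarrow> (nat \<Rightarrow> real vec) \<Rightarrow> complex vec" where
  "beam D X = vec (antennas D) (\<lambda>n. symbols D \<bullet> map_vec complex_of_real (X n))"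

text \<open>Optimal values are suprema in the extended reals (\<open>-\<infinity>\<close> for an infeasible problem).\<close>

definition opt_value_P :: "problem_data \<Rightarrow> ereal" where
  "opt_value_P D = (SUP (w, \<mu>, \<tau>) \<in> {(w, \<mu>, \<tau>). feasible_P D w \<mu> \<tau>}. ereal (objective D \<mu> \<tau>))"

definition opt_value_P2 :: "problem_data \<Rightarrow> ereal" where
  "opt_value_P2 D = (SUP (W, X, Y, \<mu>, \<tau>) \<in> {(W, X, Y, \<mu>, \<tau>). feasible_P2 D W X Y \<mu> \<tau>}.
     ereal (objective D \<mu> \<tau>))"

definition optimal_P :: "problem_data \<Rightarrow> complex vec \<Rightarrow> real vec \<Rightarrow> real \<Rightarrow> bool" where
  "optimal_P D w \<mu> \<tau> \<longleftrightarrow>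
     is_arg_max (\<lambda>(w, \<mu>, \<tau>). objective D \<mu> \<tau>) (\<lambda>(w, \<mu>, \<tau>). feasible_P D w \<mu> \<tau>) (w, \<mu>, \<tau>)"

definition optimal_P2 ::
  "problem_data \<Rightarrow> complex mat \<Rightarrow> (nat \<Rightarrow> real vec) \<Rightarrow> (nat \<Rightarrow> nat \<Rightarrow> real mat) \<Rightarrow>
    real vec \<Rightarrow> real \<Rightarrow> bool" where
  "optimal_P2 D W X Y \<mu> \<tau> \<longleftrightarrow>
     is_arg_max (\<lambda>(W, X, Y, \<mu>, \<tau>). objective D \<mu> \<tau>)
       (\<lambda>(W, X, Y, \<mu>, \<tau>). feasible_P2 D W X Y \<mu> \<tau>) (W, X, Y, \<mu>, \<tau>)"

lemma trace_mult_real: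
  assumes "A \<in> carrier_mat k k" "W \<in> carrier_mat k k"
    and "\<And>i j. i < k \<Longrightarrow> j < k \<Longrightarrow> A $$ (j, i) = cnj (A $$ (i, j))"
    and "\<And>i j. i < k \<Longrightarrow> j < k \<Longrightarrow> W $$ (j, i) = cnj (W $$ (i, j))"
  shows "trace (A * W) \<in> \<real>"
proof -
  have eq: "trace (A * W) = (\<Sum>i<k. \<Sum>j<k. A $$ (i, j) * W $$ (j, i))"
    using assms(1,2) by (auto simp: trace_def scalar_prod_def atLeast0LessThan intro!: sum.cong)
  have "cnj (trace (A * W)) = (\<Sum>i<k. \<Sum>j<k. A $$ (j, i) * W $$ (i, j))"
    unfolding eq cnj_sum complex_cnj_mult
    by (intro sum.cong refl arg_cong2[where f = "(*)"] assms(3,4)[symmetric]) auto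
  also have "\<dots> = trace (A * W)"
    unfolding eq by (rule sum.swap)
  finally show ?thesis
    by (simp add: Reals_cnj_iff)
qed

lemma herm_form_real:
  assumes "A \<in> carrier_mat k k" "w \<in> carrier_vec k"
    and "\<And>i j. i < k \<Longrightarrow> j < k \<Longrightarrow> A $$ (j, i) = cnj (A $$ (i, j))"
  shows "herm_form A w \<in> \<real>"
proof -
  have "herm_form A w = trace (A * outer_prod w (conjugate w))"
    using assms(1,2)
    by (auto simp: herm_form_def trace_def outer_prod_def scalar_prod_def atLeast0LessThan
        sum_distrib_left algebra_simps intro!: sum.cong)
  moreover have "trace (A * outer_prod w (conjugate w)) \<in> \<real>"
    by (rule trace_mult_real[OF assms(1) _ assms(3)])
      (use assms(2) in \<open>auto simp: outer_prod_def\<close>)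
  ultimately show ?thesis by simp
qed

lemma H_mat_hermitian:
  assumes "channel D u \<in> carrier_vec k"
  shows "H_mat D u \<in> carrier_mat k k"
    and "i < k \<Longrightarrow> j < k \<Longrightarrow> H_mat D u $$ (j, i) = cnj (H_mat D u $$ (i, j))"
  using assms by (auto simp: H_mat_def outer_prod_def)

lemma G_mat_hermitian:
  shows "G_mat D \<theta> \<in> carrier_mat (antennas D) (antennas D)"
    and "i < antennas D \<Longrightarrow> j < antennas D \<Longrightarrow>
      G_mat D \<theta> $$ (j, i) = cnj (G_mat D \<theta> $$ (i, j))"
  by (auto simp: G_mat_def outer_prod_def steering_def)

lemma feasible_P2_hermitian:
  assumes "feasible_P2 D W X Y \<mu> \<tau>" "i < antennas D" "j < antennas D"
  shows "W $$ (j, i) = cnj (W $$ (i, j))"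
proof -
  have "\<forall>n<antennas D. \<forall>m\<in>{n<..<antennas D}. W $$ (m, n) = cnj (W $$ (n, m))"
    using assms(1) unfolding feasible_P2_def Let_def by (elim conjE)
  then have off: "W $$ (m, n) = cnj (W $$ (n, m))" if "n < m" "m < antennas D" for n m
    by (meson greaterThanLessThan_iff less_trans that)
  have "\<forall>n<antennas D. W $$ (n, n) = complex_of_real ((amplitude D)\<^sup>2)"
    using assms(1) unfolding feasible_P2_def Let_def by (elim conjE)
  then have diag: "W $$ (n, n) = complex_of_real ((amplitude D)\<^sup>2)" if "n < antennas D" for n
    using that by blast
  show ?thesis
  proof (cases i j rule: linorder_cases)
    case less
    then show ?thesis using off assms(3) by blast
  next
    case equal
    then show ?thesis using diag[OF assms(2)] by (metis complex_cnj_complex_of_real)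
  next
    case greater
    then show ?thesis using off[OF greater assms(2)] by (metis complex_cnj_cnj)
  qed
qed

end

theory Submission
  imports Defs
begin

text \<open>
  A feasible \<open>x\<^sub>n\<close> is a unit vector, so it selects one symbol \<open>[w]\<^sub>n\<close>.  A nonnegative matrix whose
  row and column sums are unit vectors is their outer product, so \<open>Y\<^sub>n\<^sub>,\<^sub>m = x\<^sub>n x\<^sub>m\<^sup>T\<close> is forced and
  the linear constraint on \<open>[W]\<^sub>n\<^sub>,\<^sub>m\<close> reads \<open>[W]\<^sub>n\<^sub>,\<^sub>m = [w]\<^sub>n [w]\<^sub>m\<^sup>*\<close>.  All symbols have modulus
  \<open>\<delta>\<close>, so this also holds on the diagonal; thus \<open>W = w w\<^sup>H\<close>, and the traces are the quadratic forms.
\<close>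

section \<open>Outer products, traces and sums of entries\<close>

lemma outer_prod_carrier [simp]:
  "u \<in> carrier_vec k \<Longrightarrow> v \<in> carrier_vec l \<Longrightarrow> outer_prod u v \<in> carrier_mat k l"
  by (auto simp: outer_prod_def)

lemma outer_prod_index [simp]:
  "i < dim_vec u \<Longrightarrow> j < dim_vec v \<Longrightarrow> outer_prod u v $$ (i, j) = u $ i * v $ j"
  by (simp add: outer_prod_def)

lemma all_ones_scalar_prod:
  fixes v :: "'a::semiring_1 vec"
  assumes "v \<in> carrier_vec k"
  shows "all_ones k \<bullet> v = (\<Sum>i<k. v $ i)"
  using assms by (auto simp: all_ones_def scalar_prod_def atLeast0LessThan)

lemma scalar_prod_all_ones:
  fixes v :: "'a::semiring_1 vec"
  assumes "v \<in> carrier_vec k"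
  shows "v \<bullet> all_ones k = (\<Sum>i<k. v $ i)"
  using assms by (auto simp: all_ones_def scalar_prod_def atLeast0LessThan)

text \<open>Cyclicity of the trace: Tr(A w w^H) = w^H A w. This turns each constraint linear in W
  into the quadratic one in w once W is known to be w w^H.\<close>

lemma trace_outer_prod_conjugate:
  assumes "A \<in> carrier_mat k k" "w \<in> carrier_vec k"
  shows "trace (A * outer_prod w (conjugate w)) = herm_form A w"
  using assms
  by (auto simp: herm_form_def trace_def outer_prod_def scalar_prod_def atLeast0LessThan
      sum_distrib_left algebra_simps intro!: sum.cong)

text \<open>The inner product v^T x is a scalar and leaves the trace, and Tr(u y^T) = u^T y. Applied
  to S = s^* s^T, this splits the trace into one factor per antenna.\<close>

lemma trace_outer_prod_mult:
  fixes u v x y :: "'a::comm_semiring_0 vec"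
  assumes "u \<in> carrier_vec k" "v \<in> carrier_vec k" "x \<in> carrier_vec k" "y \<in> carrier_vec k"
  shows "trace (outer_prod u v * outer_prod x y) = (v \<bullet> x) * (u \<bullet> y)"
proof -
  have "trace (outer_prod u v * outer_prod x y) = (\<Sum>i<k. \<Sum>j<k. u $ i * v $ j * (x $ j * y $ i))"
    using assms
    by (auto simp: trace_def outer_prod_def scalar_prod_def atLeast0LessThan intro!: sum.cong)
  also have "\<dots> = (\<Sum>i<k. u $ i * y $ i) * (\<Sum>j<k. v $ j * x $ j)"
    by (simp add: sum_product algebra_simps)
  finally show ?thesis
    using assms by (simp add: scalar_prod_def atLeast0LessThan mult.commute)
qed

section \<open>Rigidity of binary vectors and of nonnegative matrices with unit marginals\<close>

lemma binary_sum_1_unit_vec: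
  fixes x :: "real vec"
  assumes x: "x \<in> carrier_vec k" and bin: "\<forall>i<k. x $ i \<in> {0, 1}"
    and sum: "all_ones k \<bullet> x = 1"
  obtains a where "a < k" "x = unit_vec k a"
proof -
  have sum1: "(\<Sum>i<k. x $ i) = 1"
    using sum all_ones_scalar_prod[OF x] by simp
  \<comment> \<open>If no entry were 1, all would be 0 and so would their sum. Removing the entry 1
    then leaves nonnegative terms with sum 0.\<close>
  obtain a where a: "a < k" "x $ a = 1"
    using sum1 bin by (metis insertE lessThan_iff singletonD sum.neutral zero_neq_one)
  have "(\<Sum>i\<in>{..<k} - {a}. x $ i) = 0"
    using sum1 a by (simp add: sum.remove[of _ a])
  moreover have "\<forall>i\<in>{..<k} - {a}. 0 \<le> x $ i"
    using bin by fastforce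
  ultimately have "\<forall>i\<in>{..<k} - {a}. x $ i = 0"
    by (subst (asm) sum_nonneg_eq_0_iff) auto
  then have "x = unit_vec k a"
    using a x by (intro eq_vecI) auto
  with a(1) show thesis
    by (rule that)
qed

text \<open>Nonnegative entries with sum 0 all vanish, which clears every row except
  \<open>a\<close> and every column except \<open>b\<close>. The sum of row \<open>a\<close> then
  forces the surviving entry to be 1. Hence letting Y range over a continuous set loses no
  exactness.\<close>

lemma nonneg_mat_unit_marginals:
  fixes Y :: "real mat"
  assumes Y: "Y \<in> carrier_mat k k" and ab: "a < k" "b < k"
    and nonneg: "\<forall>l<k. \<forall>i<k. 0 \<le> Y $$ (l, i)"
    and col: "\<forall>i<k. all_ones k \<bullet> col Y i = unit_vec k b $ i"
    and row: "\<forall>l<k. row Y l \<bullet> all_ones k = unit_vec k a $ l"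
  shows "Y = outer_prod (unit_vec k a) (unit_vec k b)"
proof -
  have col': "(\<Sum>l<k. Y $$ (l, i)) = unit_vec k b $ i" if "i < k" for i
    using col that Y by (simp add: all_ones_scalar_prod)
  have row': "(\<Sum>i<k. Y $$ (l, i)) = unit_vec k a $ l" if "l < k" for l
    using row that Y by (simp add: scalar_prod_all_ones)
  have zero: "Y $$ (l, i) = 0" if li: "l < k" "i < k" and "l \<noteq> a \<or> i \<noteq> b" for l i
    using \<open>l \<noteq> a \<or> i \<noteq> b\<close>
  proof
    assume "l \<noteq> a"
    then have "(\<Sum>i<k. Y $$ (l, i)) = 0"
      using row' li ab by simp
    then show ?thesis
      using nonneg li by (subst (asm) sum_nonneg_eq_0_iff) auto
  next
    assume "i \<noteq> b"
    then have "(\<Sum>l<k. Y $$ (l, i)) = 0"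
      using col' li ab by simp
    then show ?thesis
      using nonneg li by (subst (asm) sum_nonneg_eq_0_iff) auto
  qed
  have "(\<Sum>i<k. Y $$ (a, i)) = Y $$ (a, b)"
    using ab zero by (subst sum.remove[of _ b]) auto
  then have "Y $$ (a, b) = 1"
    using row'[of a] ab by simp
  then show ?thesis
    using Y zero by (intro eq_matI) (auto simp: outer_prod_def ab)
qed

section \<open>The symbols and the beam selected by unit vectors\<close>

lemma map_vec_unit_vec [simp]:
  "map_vec complex_of_real (unit_vec k a) = unit_vec k a"
  by (auto simp: unit_vec_def)

lemma map_mat_outer_prod [simp]:
  "map_mat complex_of_real (outer_prod u v) =
    outer_prod (map_vec complex_of_real u) (map_vec complex_of_real v)"
  by (auto simp: outer_prod_def)

lemma symbols_carrier [simp]: "symbols D \<in> carrier_vec (phase_count D)"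
  by (simp add: symbols_def)

lemma dim_symbols [simp]: "dim_vec (symbols D) = phase_count D"
  by (simp add: symbols_def)

lemma beam_carrier [simp]: "beam D X \<in> carrier_vec (antennas D)"
  by (simp add: beam_def)

lemma dim_beam [simp]: "dim_vec (beam D X) = antennas D"
  by (simp add: beam_def)

lemma beam_index:
  "n < antennas D \<Longrightarrow> beam D X $ n = symbols D \<bullet> map_vec complex_of_real (X n)"
  by (simp add: beam_def)

lemma symbols_scalar_prod_unit_vec:
  assumes "a < phase_count D"
  shows "symbols D \<bullet> unit_vec (phase_count D) a = symbols D $ a"
    and "conjugate (symbols D) \<bullet> unit_vec (phase_count D) a = cnj (symbols D $ a)"
  using assms by simp_all

lemma admissible_iff: "z \<in> admissible D \<longleftrightarrow> (\<exists>a<phase_count D. z = symbols D $ a)"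
  by (auto simp: admissible_def vec_set_def)

text \<open>The phases are real, so the exponential factor has modulus 1. This is what makes the
  prescribed diagonal of W agree with that of w w^H.\<close>

lemma symbols_mult_cnj:
  assumes "a < phase_count D"
  shows "symbols D $ a * cnj (symbols D $ a) = complex_of_real ((amplitude D)\<^sup>2)"
proof -
  have "norm (symbols D $ a) = \<bar>amplitude D\<bar>"
    using assms by (simp add: symbols_def norm_mult)
  then show ?thesis
    by (metis complex_norm_square power2_abs)
qed

text \<open>The trace factors as (s^T e_a)(s^H e_b). The conjugate in S thus falls on the symbol
  chosen by the column index of Y, as w w^H demands.\<close>

lemma trace_S_mat_unit:
  assumes "a < phase_count D" "b < phase_count D"
  shows "trace (S_mat D * map_mat complex_of_real
      (outer_prod (unit_vec (phase_count D) a) (unit_vec (phase_count D) b))) =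
    symbols D $ a * cnj (symbols D $ b)"
  using assms
  by (simp add: S_mat_def symbols_scalar_prod_unit_vec trace_outer_prod_mult[of _ "phase_count D"])

section \<open>From the linear program to the original problem\<close>

lemma feasible_P2_unit:
  assumes "feasible_P2 D W X Y \<mu> \<tau>"
  obtains a where
    "\<And>n. n < antennas D \<Longrightarrow> a n < phase_count D"
    "\<And>n. n < antennas D \<Longrightarrow> X n = unit_vec (phase_count D) (a n)"
proof -
  have "\<exists>a<phase_count D. X n = unit_vec (phase_count D) a" if "n < antennas D" for n
    using assms that binary_sum_1_unit_vec[of "X n" "phase_count D"]
    unfolding feasible_P2_def Let_def by metis
  then show thesis
    using that by metis
qed

text \<open>Each region of W has its own reason: above the diagonal Y is forced to be an outer
  product of unit vectors, on the diagonal all symbols have the same modulus, and below it W is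
  Hermitian.\<close>

lemma feasible_P2_imp_W:
  assumes feas: "feasible_P2 D W X Y \<mu> \<tau>"
  shows "W = outer_prod (beam D X) (conjugate (beam D X))"
proof -
  let ?N = "antennas D" and ?L = "phase_count D"
  obtain a where a: "\<And>n. n < ?N \<Longrightarrow> a n < ?L" "\<And>n. n < ?N \<Longrightarrow> X n = unit_vec ?L (a n)"
    using feasible_P2_unit[OF feas] by blast
  have w: "beam D X $ n = symbols D $ a n" if "n < ?N" for n
    using that a by (simp add: beam_index symbols_scalar_prod_unit_vec)
  have W: "W \<in> carrier_mat ?N ?N"
    and diag: "\<And>n. n < ?N \<Longrightarrow> W $$ (n, n) = complex_of_real ((amplitude D)\<^sup>2)"
    and WY: "\<And>n m. n < m \<Longrightarrow> m < ?N \<Longrightarrow>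
      W $$ (n, m) = trace (S_mat D * map_mat complex_of_real (Y n m))"
    and Yc: "\<And>n m. n < m \<Longrightarrow> m < ?N \<Longrightarrow> Y n m \<in> carrier_mat ?L ?L"
    and Y01: "\<And>n m l i. n < m \<Longrightarrow> m < ?N \<Longrightarrow> l < ?L \<Longrightarrow> i < ?L \<Longrightarrow> Y n m $$ (l, i) \<in> {0..1}"
    and col: "\<And>n m i. n < m \<Longrightarrow> m < ?N \<Longrightarrow> i < ?L \<Longrightarrow> all_ones ?L \<bullet> col (Y n m) i = X m $ i"
    and row: "\<And>n m l. n < m \<Longrightarrow> m < ?N \<Longrightarrow> l < ?L \<Longrightarrow> row (Y n m) l \<bullet> all_ones ?L = X n $ l"
    using feas unfolding feasible_P2_def Let_def by simp_all
  have upper: "W $$ (n, m) = beam D X $ n * cnj (beam D X $ m)" if "n < m" "m < ?N" for n m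
  proof -
    have n: "n < ?N"
      using that by simp
    have "Y n m = outer_prod (unit_vec ?L (a n)) (unit_vec ?L (a m))"
      using that n Yc Y01 col row a by (intro nonneg_mat_unit_marginals) auto
    then show ?thesis
      using WY[OF that] a that n w by (simp add: trace_S_mat_unit del: map_mat_outer_prod)
  qed
  have "W $$ (n, m) = beam D X $ n * cnj (beam D X $ m)" if nm: "n < ?N" "m < ?N" for n m
  proof (cases n m rule: linorder_cases)
    case less
    then show ?thesis using upper nm by blast
  next
    case equal
    then show ?thesis using diag w a nm by (simp add: symbols_mult_cnj)
  next
    case greater
    then show ?thesis
      using upper[OF greater nm(1)] feasible_P2_hermitian[OF feas nm(2,1)] by simp
  qed
  then show ?thesis
    using W by (intro eq_matI) (auto simp: outer_prod_def)
qed

text \<open>Each entry of the beam is a selected symbol, hence admissible. Since W is the outer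
  product of the beam with its conjugate, the trace bounds are the quadratic ones.\<close>

lemma feasible_P2_imp_feasible_P:
  assumes valid: "valid_data D" and feas: "feasible_P2 D W X Y \<mu> \<tau>"
  shows "feasible_P D (beam D X) \<mu> \<tau>"
proof -
  obtain a where a: "\<And>n. n < antennas D \<Longrightarrow> a n < phase_count D"
    "\<And>n. n < antennas D \<Longrightarrow> X n = unit_vec (phase_count D) (a n)"
    using feasible_P2_unit[OF feas] by blast
  have adm: "beam D X $ n \<in> admissible D" if "n < antennas D" for n
    using that a by (auto simp: admissible_iff beam_index symbols_scalar_prod_unit_vec)
  have H: "trace (H_mat D u * W) = herm_form (H_mat D u) (beam D X)" if "u < users D" for u
    unfolding feasible_P2_imp_W[OF feas]
    using that valid
    by (intro trace_outer_prod_conjugate[of _ "antennas D"] H_mat_hermitian)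
       (auto simp: valid_data_def)
  have G: "trace (G_mat D \<theta> * W) = herm_form (G_mat D \<theta>) (beam D X)" for \<theta>
    unfolding feasible_P2_imp_W[OF feas]
    by (intro trace_outer_prod_conjugate[of _ "antennas D"] G_mat_hermitian beam_carrier)
  show ?thesis
    using feas adm H G unfolding feasible_P_def feasible_P2_def Let_def by simp
qed

section \<open>Lifting a feasible beam to the linear program\<close>

lemma feasible_P_imp_feasible_P2:
  assumes valid: "valid_data D" and feas: "feasible_P D w \<mu> \<tau>"
  obtains W X Y where "feasible_P2 D W X Y \<mu> \<tau>" "w = beam D X"
proof -
  let ?N = "antennas D" and ?L = "phase_count D"
  have w: "w \<in> carrier_vec ?N" and "\<forall>n<?N. w $ n \<in> admissible D"
    using feas unfolding feasible_P_def Let_def by simp_all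
  then obtain a where a: "\<And>n. n < ?N \<Longrightarrow> a n < ?L" "\<And>n. n < ?N \<Longrightarrow> w $ n = symbols D $ a n"
    unfolding admissible_iff by metis
  \<comment> \<open>With \<open>a n\<close> the index of the symbol used by antenna
    \<open>n\<close>, these witnesses are the values that the converse direction shows to be
    forced.\<close>
  define W where "W = outer_prod w (conjugate w)"
  define X :: "nat \<Rightarrow> real vec" where "X n = unit_vec ?L (a n)" for n
  define Y where "Y n m = outer_prod (X n) (X m)" for n m
  have H: "trace (H_mat D u * W) = herm_form (H_mat D u) w" if "u < users D" for u
    unfolding W_def using that valid w
    by (intro trace_outer_prod_conjugate[of _ "antennas D"] H_mat_hermitian)
       (auto simp: valid_data_def)
  have G: "trace (G_mat D \<theta> * W) = herm_form (G_mat D \<theta>) w" for \<theta>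
    unfolding W_def using w
    by (intro trace_outer_prod_conjugate[of _ "antennas D"] G_mat_hermitian)
  have X: "X n \<in> carrier_vec ?L" for n
    by (simp add: X_def)
  have Y: "Y n m \<in> carrier_mat ?L ?L" for n m
    by (simp add: Y_def X)
  have W: "W \<in> carrier_mat ?N ?N"
    using w by (simp add: W_def)
  have W_index: "W $$ (n, m) = symbols D $ a n * cnj (symbols D $ a m)" if "n < ?N" "m < ?N" for n m
    using that w a by (simp add: W_def)
  have WY: "W $$ (n, m) = trace (S_mat D * map_mat complex_of_real (Y n m))"
    if "n < ?N" "m < ?N" for n m
    using W_index[OF that] trace_S_mat_unit[OF a(1)[OF that(1)] a(1)[OF that(2)]]
    by (simp add: Y_def X_def)
  \<comment> \<open>Beyond the antennas \<open>a n\<close> is arbitrary and \<open>X n\<close> may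
    be the zero vector, so the bound on \<open>n\<close> matters.\<close>
  have Xsum: "(\<Sum>l<?L. X n $ l) = 1" if "n < ?N" for n
    using a(1)[OF that] by (subst sum.remove[of _ "a n"]) (auto simp: X_def)
  have Y_index: "Y n m $$ (l, i) = X n $ l * X m $ i" if "l < ?L" "i < ?L" for n m l i
    using that by (simp add: Y_def X_def)
  have Xbin: "X n $ l \<in> {0, 1}" if "l < ?L" "n < ?N" for n l
    using that a by (auto simp: X_def unit_vec_def)
  have Ybin: "Y n m $$ (l, i) \<in> {0..1}" if "l < ?L" "i < ?L" "n < ?N" "m < ?N" for n m l i
    using Xbin[of l n] Xbin[of i m] that by (auto simp: Y_index)
  \<comment> \<open>Summing out the row index of the outer product leaves the entry sum of
    \<open>X n\<close>, which is 1, as a factor. The bound is therefore on \<open>n\<close> here and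
    on \<open>m\<close> for the row sums.\<close>
  have col: "all_ones ?L \<bullet> col (Y n m) i = X m $ i" if "i < ?L" "n < ?N" for n m i
    using that Y Xsum[OF that(2)]
    by (simp add: all_ones_scalar_prod carrier_matD[OF Y] Y_index flip: sum_distrib_right)
  have row: "row (Y n m) l \<bullet> all_ones ?L = X n $ l" if "l < ?L" "m < ?N" for n m l
    using that Y Xsum[OF that(2)]
    by (simp add: scalar_prod_all_ones carrier_matD[OF Y] Y_index flip: sum_distrib_left)
  have "feasible_P2 D W X Y \<mu> \<tau>"
    unfolding feasible_P2_def Let_def
  proof (intro conjI)
    show "\<forall>n<?N. \<forall>m\<in>{n<..<?N}. W $$ (m, n) = cnj (W $$ (n, m))"
      by (auto simp: W_index)
    show "\<forall>n<?N. W $$ (n, n) = complex_of_real ((amplitude D)\<^sup>2)"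
      using a by (simp add: W_index symbols_mult_cnj)
    show "\<forall>n<?N. all_ones ?L \<bullet> X n = 1"
      using Xsum X by (simp add: all_ones_scalar_prod)
    show "\<forall>n<?N. \<forall>m\<in>{n<..<?N}. \<forall>l<?L. \<forall>i<?L. Y n m $$ (l, i) \<in> {0..1}"
      using Ybin by simp
  qed (use feas H G W X Y WY Xbin col row in \<open>simp_all add: feasible_P_def Let_def\<close>)
  moreover have "w = beam D X"
    using w a by (intro eq_vecI) (auto simp: beam_index X_def symbols_scalar_prod_unit_vec)
  ultimately show thesis
    by (rule that)
qed

section \<open>Transfer of feasibility, optimal values and maximizers\<close>

theorem mainTheorem1:
  fixes D :: problem_data
  assumes "valid_data D"
  shows "(\<forall>w \<in> carrier_vec (antennas D). \<forall>\<mu> \<in> carrier_vec (users D). \<forall>\<tau>.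
            feasible_P D w \<mu> \<tau> \<longleftrightarrow>
            (\<exists>W X Y. feasible_P2 D W X Y \<mu> \<tau> \<and>
               (\<forall>n<antennas D. w $ n = symbols D \<bullet> map_vec complex_of_real (X n))))
       \<and> opt_value_P D = opt_value_P2 D
       \<and> (\<forall>W X Y \<mu> \<tau>. optimal_P2 D W X Y \<mu> \<tau> \<longrightarrow> optimal_P D (beam D X) \<mu> \<tau>)"
proof (intro conjI ballI allI impI)
  fix w :: "complex vec" and \<mu> \<tau>
  assume w: "w \<in> carrier_vec (antennas D)"
  have w_eq: "(\<forall>n<antennas D. w $ n = symbols D \<bullet> map_vec complex_of_real (X n)) \<longleftrightarrow> w = beam D X"
    for X
    using w by (auto simp: beam_index)
  show "feasible_P D w \<mu> \<tau> \<longleftrightarrow> (\<exists>W X Y. feasible_P2 D W X Y \<mu> \<tau> \<and>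
      (\<forall>n<antennas D. w $ n = symbols D \<bullet> map_vec complex_of_real (X n)))"
    unfolding w_eq
  proof
    assume "feasible_P D w \<mu> \<tau>"
    then obtain W X Y where "feasible_P2 D W X Y \<mu> \<tau>" "w = beam D X"
      by (rule feasible_P_imp_feasible_P2[OF assms])
    then show "\<exists>W X Y. feasible_P2 D W X Y \<mu> \<tau> \<and> w = beam D X"
      by blast
  next
    assume "\<exists>W X Y. feasible_P2 D W X Y \<mu> \<tau> \<and> w = beam D X"
    then show "feasible_P D w \<mu> \<tau>"
      using feasible_P2_imp_feasible_P[OF assms] by blast
  qed
next
  show "opt_value_P D = opt_value_P2 D"
    unfolding opt_value_P_def opt_value_P2_def
  \<comment> \<open>A feasible point of either problem yields one of the other with the same \<mu>
    and \<tau>, hence the same objective. Suprema in the extended reals cover infeasible and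
    unbounded problems without a case split.\<close>
  proof (rule antisym; rule SUP_least; clarify)
    fix w \<mu> \<tau>
    assume "feasible_P D w \<mu> \<tau>"
    then obtain W X Y where "feasible_P2 D W X Y \<mu> \<tau>"
      by (rule feasible_P_imp_feasible_P2[OF assms])
    then show "ereal (objective D \<mu> \<tau>) \<le> (SUP (W, X, Y, \<mu>, \<tau>) \<in>
        {(W, X, Y, \<mu>, \<tau>). feasible_P2 D W X Y \<mu> \<tau>}. ereal (objective D \<mu> \<tau>))"
      by (intro SUP_upper2[of "(W, X, Y, \<mu>, \<tau>)"]) auto
  next
    fix W X Y \<mu> \<tau>
    assume "feasible_P2 D W X Y \<mu> \<tau>"
    then have "feasible_P D (beam D X) \<mu> \<tau>"
      by (rule feasible_P2_imp_feasible_P[OF assms])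
    then show "ereal (objective D \<mu> \<tau>) \<le> (SUP (w, \<mu>, \<tau>) \<in>
        {(w, \<mu>, \<tau>). feasible_P D w \<mu> \<tau>}. ereal (objective D \<mu> \<tau>))"
      by (intro SUP_upper2[of "(beam D X, \<mu>, \<tau>)"]) auto
  qed
next
  fix W X Y \<mu> \<tau>
  assume opt: "optimal_P2 D W X Y \<mu> \<tau>"
  then have "feasible_P D (beam D X) \<mu> \<tau>"
    by (auto simp: optimal_P2_def is_arg_max_def intro: feasible_P2_imp_feasible_P[OF assms])
  \<comment> \<open>A strictly better beam would lift to a strictly better point of the linear
    program.\<close>
  moreover have "\<not> objective D \<mu> \<tau> < objective D \<mu>' \<tau>'"
    if feas: "feasible_P D w' \<mu>' \<tau>'" for w' \<mu>' \<tau>'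
  proof -
    from feas obtain W' X' Y' where "feasible_P2 D W' X' Y' \<mu>' \<tau>'"
      by (rule feasible_P_imp_feasible_P2[OF assms])
    then show ?thesis
      using opt by (simp add: optimal_P2_def is_arg_max_def)
  qed
  ultimately show "optimal_P D (beam D X) \<mu> \<tau>"
    by (auto simp: optimal_P_def is_arg_max_def)
qed

end
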